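(* Let $G$ be a finite group, let $I$ and $\Lambda$ be finite nonempty index sets, and let $P=(p_{\lambda i})$ be a $\Lambda\times I$ matrix with entries in $G$. Suppose that $|I|>1$ or $|\Lambda|>1$. Then: (1) If $G$ is abelian, then $\omega(\mathcal{G}(\mathcal{M}[G;I,\Lambda;P]))=|G|$. (2) If $G$ is non-abelian, then $\omega(\mathcal{G}(\mathcal{M}[G;I,\Lambda;P]))=|Z(G)|+\omega(\mathcal{G}(G))$.
   Context: The Rees matrix semigroup $\mathcal{M}[G;I,\Lambda;P]$ over the group $G$ is the set $I\times G\times\Lambda$ with multiplication $(i,x,\lambda)(j,y,\mu)=(i,xp_{\lambda j}y,\mu)$. The center of a semigroup $S$ is $Z(S)=\{x\in S: xy=yx\text{ for all }y\in S\}$. For a finite non-commutative semigroup $S$, the commuting graph $\mathcal{G}(S)$ is the simple graph with vertex set $S\setminus Z(S)$ in which two distinct vertices $x,y$ are adjacent if and only if $xy=yx$. (Under the hypotheses of the claim, $\mathcal{M}[G;I,\Lambda;P]$ is non-commutative.) The clique number $\omega(\Gamma)$ of a graph $\Gamma$ is the size of a largest set of pairwise adjacent vertices. *)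

theory Defs
  imports "HOL-Algebra.Coset" "HOL-Library.Ramsey"
begin

text \<open>
  HOL-Algebra has no record for semigroups without a unit, so a semigroup is given here by its
  carrier set and its operation; a group \<open>G\<close> is viewed as the semigroup with carrier
  \<open>carrier G\<close> and operation \<open>mult G\<close>.
\<close>

definition center :: "'a set \<Rightarrow> ('a \<Rightarrow> 'a \<Rightarrow> 'a) \<Rightarrow> 'a set" where
  "center S f = {x \<in> S. \<forall>y\<in>S. f x y = f y x}"

text \<open>
  A simple graph is a pair of a vertex set and a set of two-element edges, the edge format of
  \<^const>\<open>clique\<close> from \<^theory>\<open>HOL-Library.Ramsey\<close>.
\<close>

type_synonym 'a simple_graph = "'a set \<times> 'a set set"

definition commuting_graph :: "'a set \<Rightarrow> ('a \<Rightarrow> 'a \<Rightarrow> 'a) \<Rightarrow> 'a simple_graph" where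
  "commuting_graph S f =
     (S - center S f,
      {{x, y} | x y. x \<in> S - center S f \<and> y \<in> S - center S f \<and> x \<noteq> y \<and> f x y = f y x})"

text \<open>
  Meaningful for finite graphs, where the maximum exists since the empty set is a clique.
\<close>

definition clique_number :: "'a simple_graph \<Rightarrow> nat" where
  "clique_number \<Gamma> = Max {card K | K. K \<subseteq> fst \<Gamma> \<and> clique K (snd \<Gamma>)}"

definition rees_carrier ::
    "('g, 'm) monoid_scheme \<Rightarrow> 'i set \<Rightarrow> 'l set \<Rightarrow> ('i \<times> 'g \<times> 'l) set" where
  "rees_carrier G I \<Lambda> = I \<times> carrier G \<times> \<Lambda>"

definition rees_mult ::
    "('g, 'm) monoid_scheme \<Rightarrow> ('l \<Rightarrow> 'i \<Rightarrow> 'g) \<Rightarrow>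
      'i \<times> 'g \<times> 'l \<Rightarrow> 'i \<times> 'g \<times> 'l \<Rightarrow> 'i \<times> 'g \<times> 'l" where
  "rees_mult G P = (\<lambda>(i, x, l) (j, y, m). (i, x \<otimes>\<^bsub>G\<^esub> P l j \<otimes>\<^bsub>G\<^esub> y, m))"

lemma rees_mult_closed:
  assumes "group G" and "\<forall>l\<in>\<Lambda>. \<forall>i\<in>I. P l i \<in> carrier G"
    and "a \<in> rees_carrier G I \<Lambda>" and "b \<in> rees_carrier G I \<Lambda>"
  shows "rees_mult G P a b \<in> rees_carrier G I \<Lambda>"
proof -
  interpret group G by fact
  show ?thesis using assms by (auto simp: rees_carrier_def rees_mult_def)
qed

lemma rees_mult_assoc:
  assumes "group G" and "\<forall>l\<in>\<Lambda>. \<forall>i\<in>I. P l i \<in> carrier G"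
    and "a \<in> rees_carrier G I \<Lambda>" and "b \<in> rees_carrier G I \<Lambda>" and "c \<in> rees_carrier G I \<Lambda>"
  shows "rees_mult G P (rees_mult G P a b) c = rees_mult G P a (rees_mult G P b c)"
proof -
  interpret group G by fact
  show ?thesis using assms by (auto simp: rees_carrier_def rees_mult_def m_assoc)
qed

lemma rees_center_empty:
  assumes "group G" and "I \<noteq> {}" and "\<Lambda> \<noteq> {}" and "card I > 1 \<or> card \<Lambda> > 1"
  shows "center (rees_carrier G I \<Lambda>) (rees_mult G P) = {}"
proof (rule equals0I)
  interpret group G by fact
  fix a assume a: "a \<in> center (rees_carrier G I \<Lambda>) (rees_mult G P)"
  obtain i x l where a_eq: "a = (i, x, l)" by (cases a)
  have comm: "j = i \<and> m = l" if "j \<in> I" "m \<in> \<Lambda>" for j m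
  proof -
    have "(j, \<one>\<^bsub>G\<^esub>, m) \<in> rees_carrier G I \<Lambda>" using that by (simp add: rees_carrier_def)
    then show ?thesis using a a_eq by (fastforce simp: center_def rees_mult_def)
  qed
  from assms(2,3) have "I \<subseteq> {i}" and "\<Lambda> \<subseteq> {l}" using comm by auto
  then have "card I \<le> 1" and "card \<Lambda> \<le> 1" using card_mono[of "{i}" I] card_mono[of "{l}" \<Lambda>] by auto
  with assms(4) show False by simp
qed

end

theory Submission
  imports Defs
begin

text \<open>
  Cliques of a commuting graph avoid the center, which makes them awkward to transport between
  semigroups. The proof therefore works with the largest size of a set of pairwise commuting
  elements, central ones included. Central elements can always be added to such a set, so this
  size is the size of the center plus the clique number (\<open>commuting_width_eq\<close>).

  Products in a Rees matrix semigroup keep the first index of the left factor and the last index of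
  the right factor, so commuting elements \<open>(i, x, \<lambda>)\<close>, \<open>(j, y, \<mu>)\<close> satisfy
  \<open>i = j\<close> and \<open>\<lambda> = \<mu>\<close>. A commuting set thus lies in a single block
  \<open>{i} \<times> G \<times> {\<lambda>}\<close>, and such a block is a copy of \<open>G\<close> under
  \<open>(i, x, \<lambda>) \<mapsto> x p\<^sub>\<lambda>\<^sub>i\<close>. Hence the semigroup and the group have commuting sets
  of the same sizes (\<open>commuting_width_rees\<close>). Since the center of the Rees matrix semigroup is
  empty, its clique number is the largest size of a commuting subset of \<open>G\<close>: this is
  \<open>|G|\<close> when \<open>G\<close> is abelian, and \<open>|Z(G)| + \<omega>(\<G>(G))\<close> in any case.
\<close>

definition commuting_set :: "'a set \<Rightarrow> ('a \<Rightarrow> 'a \<Rightarrow> 'a) \<Rightarrow> 'a set \<Rightarrow> bool" where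
  "commuting_set S f K \<longleftrightarrow> K \<subseteq> S \<and> (\<forall>x\<in>K. \<forall>y\<in>K. f x y = f y x)"

definition commuting_width :: "'a set \<Rightarrow> ('a \<Rightarrow> 'a \<Rightarrow> 'a) \<Rightarrow> nat" where
  "commuting_width S f = Max {card K | K. commuting_set S f K}"

lemma finite_cards_of_subsets:
  assumes "finite S" and "\<And>K. Q K \<Longrightarrow> K \<subseteq> S"
  shows "finite {card K | K. Q K}"
proof -
  have "{card K | K. Q K} \<subseteq> card ` Pow S" using assms(2) by auto
  with assms(1) show ?thesis by (meson finite_Pow_iff finite_imageI finite_subset)
qed

lemma finite_cards_commuting_sets: "finite S \<Longrightarrow> finite {card K | K. commuting_set S f K}"
  by (rule finite_cards_of_subsets) (auto simp: commuting_set_def)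

lemma card_le_commuting_width:
  assumes "finite S" and "commuting_set S f K"
  shows "card K \<le> commuting_width S f"
  unfolding commuting_width_def
  using assms by (intro Max_ge finite_cards_commuting_sets) auto

lemma commuting_width_attained:
  assumes "finite S"
  obtains K where "commuting_set S f K" and "card K = commuting_width S f"
proof -
  have "commuting_set S f {}" by (simp add: commuting_set_def)
  then have "commuting_width S f \<in> {card K | K. commuting_set S f K}"
    unfolding commuting_width_def
    using assms by (intro Max_in finite_cards_commuting_sets) auto
  then show thesis using that by auto
qed

lemma commuting_graph_edge_iff:
  "{x, y} \<in> snd (commuting_graph S f) \<longleftrightarrow>
    x \<in> S - center S f \<and> y \<in> S - center S f \<and> x \<noteq> y \<and> f x y = f y x"
  by (auto simp: commuting_graph_def doubleton_eq_iff)

lemma commuting_graph_clique_iff: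
  "K \<subseteq> fst (commuting_graph S f) \<and> clique K (snd (commuting_graph S f)) \<longleftrightarrow>
    commuting_set S f K \<and> K \<inter> center S f = {}"
proof -
  have "fst (commuting_graph S f) = S - center S f" by (simp add: commuting_graph_def)
  then show ?thesis
    unfolding clique_def commuting_set_def commuting_graph_edge_iff by auto
qed

lemma clique_number_commuting_graph:
  "clique_number (commuting_graph S f) =
    Max {card K | K. commuting_set S f K \<and> K \<inter> center S f = {}}"
  by (simp only: clique_number_def commuting_graph_clique_iff)

text \<open>
  Removing the center from a largest commuting set leaves a clique, and adding the center to a
  largest clique gives a commuting set.
\<close>

lemma commuting_width_eq:
  assumes fin: "finite S"
  shows "commuting_width S f = card (center S f) + clique_number (commuting_graph S f)"
proof (rule antisym)
  let ?Z = "center S f"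
  let ?C = "{card K | K. commuting_set S f K \<and> K \<inter> ?Z = {}}"
  have finZ: "finite ?Z" using fin by (simp add: center_def)
  have finC: "finite ?C"
    using fin by (rule finite_cards_of_subsets) (auto simp: commuting_set_def)
  show "commuting_width S f \<le> card ?Z + clique_number (commuting_graph S f)"
  proof -
    obtain K where K: "commuting_set S f K" "card K = commuting_width S f"
      using commuting_width_attained[OF fin] .
    have finK: "finite K" using K(1) fin finite_subset by (auto simp: commuting_set_def)
    have "card (K - ?Z) \<in> ?C" using K(1) by (auto simp: commuting_set_def)
    then have "card (K - ?Z) \<le> clique_number (commuting_graph S f)"
      using finC by (simp only: clique_number_commuting_graph Max_ge)
    moreover have "card K \<le> card (?Z \<union> (K - ?Z))"
      using finK finZ by (intro card_mono) auto
    moreover have "card (?Z \<union> (K - ?Z)) \<le> card ?Z + card (K - ?Z)" by (rule card_Un_le)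
    ultimately show ?thesis using K(2) by linarith
  qed
  show "card ?Z + clique_number (commuting_graph S f) \<le> commuting_width S f"
  proof -
    have "commuting_set S f {} \<and> {} \<inter> ?Z = {}" by (simp add: commuting_set_def)
    then have "clique_number (commuting_graph S f) \<in> ?C"
      unfolding clique_number_commuting_graph using finC by (intro Max_in) auto
    then obtain K where K: "commuting_set S f K" "K \<inter> ?Z = {}"
      "card K = clique_number (commuting_graph S f)" by auto
    have "finite K" using K(1) fin finite_subset by (auto simp: commuting_set_def)
    then have "card (?Z \<union> K) = card ?Z + card K"
      using finZ K(2) by (intro card_Un_disjoint) auto
    moreover have "commuting_set S f (?Z \<union> K)"
      using K(1) by (auto simp: commuting_set_def center_def)
    ultimately show ?thesis using card_le_commuting_width[OF fin] K(3) by metis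
  qed
qed

text \<open>
  Multiplying \<open>x p y = y p x\<close> on the right by \<open>p\<close> gives
  \<open>(x p)(y p) = (y p)(x p)\<close>, and \<open>p\<close> can be cancelled again.
\<close>

lemma rees_commute_iff:
  assumes "group G" and "P l i \<in> carrier G" and "x \<in> carrier G" and "y \<in> carrier G"
  shows "rees_mult G P (i, x, l) (j, y, m) = rees_mult G P (j, y, m) (i, x, l) \<longleftrightarrow>
    i = j \<and> l = m \<and>
    (x \<otimes>\<^bsub>G\<^esub> P l i) \<otimes>\<^bsub>G\<^esub> (y \<otimes>\<^bsub>G\<^esub> P l i) = (y \<otimes>\<^bsub>G\<^esub> P l i) \<otimes>\<^bsub>G\<^esub> (x \<otimes>\<^bsub>G\<^esub> P l i)"
proof -
  interpret group G by fact
  let ?p = "P l i"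
  have assoc: "(u \<otimes>\<^bsub>G\<^esub> ?p) \<otimes>\<^bsub>G\<^esub> (v \<otimes>\<^bsub>G\<^esub> ?p) = (u \<otimes>\<^bsub>G\<^esub> ?p \<otimes>\<^bsub>G\<^esub> v) \<otimes>\<^bsub>G\<^esub> ?p"
    if "u \<in> carrier G" "v \<in> carrier G" for u v
    using that assms(2) by (simp add: m_assoc)
  have "x \<otimes>\<^bsub>G\<^esub> ?p \<otimes>\<^bsub>G\<^esub> y = y \<otimes>\<^bsub>G\<^esub> ?p \<otimes>\<^bsub>G\<^esub> x \<longleftrightarrow>
    (x \<otimes>\<^bsub>G\<^esub> ?p) \<otimes>\<^bsub>G\<^esub> (y \<otimes>\<^bsub>G\<^esub> ?p) = (y \<otimes>\<^bsub>G\<^esub> ?p) \<otimes>\<^bsub>G\<^esub> (x \<otimes>\<^bsub>G\<^esub> ?p)"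
    using assms(2-4) by (simp only: assoc right_cancel m_closed)
  then show ?thesis by (auto simp: rees_mult_def)
qed

text \<open>
  Each inequality transports a largest commuting set. From the semigroup to the group the map is
  \<open>(i, x, \<lambda>) \<mapsto> x p\<^sub>\<lambda>\<^sub>i\<close>, which is injective on a commuting set because
  the set lies in one block. In the other direction any choice of block works, with the inverse map
  \<open>x \<mapsto> (i, x p\<^sub>\<lambda>\<^sub>i\<^sup>-\<^sup>1, \<lambda>)\<close>.
\<close>

lemma commuting_width_rees:
  fixes G :: "('g, 'm) monoid_scheme"
    and I :: "'i set" and \<Lambda> :: "'l set"
    and P :: "'l \<Rightarrow> 'i \<Rightarrow> 'g"
  assumes grp: "group G" and finG: "finite (carrier G)"
    and finI: "finite I" and "I \<noteq> {}" and finL: "finite \<Lambda>" and "\<Lambda> \<noteq> {}"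
    and P: "\<forall>l\<in>\<Lambda>. \<forall>i\<in>I. P l i \<in> carrier G"
  shows "commuting_width (rees_carrier G I \<Lambda>) (rees_mult G P) =
    commuting_width (carrier G) (mult G)"
proof (rule antisym)
  interpret group G by fact
  let ?S = "rees_carrier G I \<Lambda>" and ?f = "rees_mult G P"
  have finS: "finite ?S" using finI finG finL by (simp add: rees_carrier_def)
  show "commuting_width ?S ?f \<le> commuting_width (carrier G) (mult G)"
  proof -
    obtain K where K: "commuting_set ?S ?f K" "card K = commuting_width ?S ?f"
      using commuting_width_attained[OF finS] .
    show ?thesis
    proof (cases "K = {}")
      case True
      then show ?thesis using K(2) by simp
    next
      case False
      then obtain i z l where base: "(i, z, l) \<in> K" by auto
      have mem: "j \<in> I \<and> x \<in> carrier G \<and> m \<in> \<Lambda>" if "(j, x, m) \<in> K" for j x m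
        using that K(1) by (auto simp: commuting_set_def rees_carrier_def)
      have p: "P l i \<in> carrier G" using mem[OF base] P by auto
      have comm: "?f a b = ?f b a" if "a \<in> K" "b \<in> K" for a b
        using K(1) that by (auto simp: commuting_set_def)
      \<comment> \<open>Comparing outer indices in the two products with one fixed element pins down the block.\<close>
      have block: "\<exists>x. a = (i, x, l) \<and> x \<in> carrier G" if "a \<in> K" for a
      proof -
        obtain j x m where a: "a = (j, x, m)" by (cases a)
        then have "(j, x, m) \<in> K" using that by simp
        from comm[OF base this] mem[OF this] mem[OF base] show ?thesis
          by (simp add: a rees_mult_def)
      qed
      define h where "h = (\<lambda>(j :: 'i, x, m :: 'l). x \<otimes>\<^bsub>G\<^esub> P l i)"
      have inj: "inj_on h K"
      proof (rule inj_onI)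
        fix a b assume ab: "a \<in> K" "b \<in> K" "h a = h b"
        obtain x where x: "a = (i, x, l)" "x \<in> carrier G" using block[OF ab(1)] by blast
        obtain y where y: "b = (i, y, l)" "y \<in> carrier G" using block[OF ab(2)] by blast
        from ab(3) show "a = b" by (simp add: h_def x y p)
      qed
      have "commuting_set (carrier G) (mult G) (h ` K)"
        unfolding commuting_set_def
      proof (intro conjI ballI)
        show "h ` K \<subseteq> carrier G"
        proof (rule image_subsetI)
          fix a assume "a \<in> K"
          then obtain x where "a = (i, x, l)" "x \<in> carrier G" using block by blast
          then show "h a \<in> carrier G" using p by (simp add: h_def)
        qed
      next
        fix u v assume "u \<in> h ` K" "v \<in> h ` K"
        then obtain a b where ab: "a \<in> K" "b \<in> K" and uv: "u = h a" "v = h b" by blast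
        obtain x where x: "a = (i, x, l)" "x \<in> carrier G" using block[OF ab(1)] by blast
        obtain y where y: "b = (i, y, l)" "y \<in> carrier G" using block[OF ab(2)] by blast
        show "u \<otimes>\<^bsub>G\<^esub> v = v \<otimes>\<^bsub>G\<^esub> u"
          using comm[OF ab] rees_commute_iff[where P = P, OF grp p x(2) y(2), of i l]
          by (simp add: uv x(1) y(1) h_def)
      qed
      then have "card (h ` K) \<le> commuting_width (carrier G) (mult G)"
        by (rule card_le_commuting_width[OF finG])
      then show ?thesis using K(2) card_image[OF inj] by simp
    qed
  qed
  show "commuting_width (carrier G) (mult G) \<le> commuting_width ?S ?f"
  proof -
    obtain K where K: "commuting_set (carrier G) (mult G) K"
      "card K = commuting_width (carrier G) (mult G)"
      using commuting_width_attained[OF finG] .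
    obtain i l where il: "i \<in> I" "l \<in> \<Lambda>" using assms(4,6) by blast
    then have p: "P l i \<in> carrier G" using P by auto
    have sub: "K \<subseteq> carrier G" using K(1) by (simp add: commuting_set_def)
    define h where "h = (\<lambda>x. (i, x \<otimes>\<^bsub>G\<^esub> inv\<^bsub>G\<^esub> P l i, l))"
    have cancel: "(x \<otimes>\<^bsub>G\<^esub> inv\<^bsub>G\<^esub> P l i) \<otimes>\<^bsub>G\<^esub> P l i = x" if "x \<in> K" for x
      using subsetD[OF sub that] p by (simp add: m_assoc)
    have inj: "inj_on h K"
    proof (rule inj_onI)
      fix x y assume xy: "x \<in> K" "y \<in> K" "h x = h y"
      have "x \<otimes>\<^bsub>G\<^esub> inv\<^bsub>G\<^esub> P l i = y \<otimes>\<^bsub>G\<^esub> inv\<^bsub>G\<^esub> P l i"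
        using xy(3) unfolding h_def prod.inject by (elim conjE)
      from arg_cong[OF this, of "\<lambda>u. u \<otimes>\<^bsub>G\<^esub> P l i"] show "x = y"
        unfolding cancel[OF xy(1)] cancel[OF xy(2)] .
    qed
    have "commuting_set ?S ?f (h ` K)"
      unfolding commuting_set_def
    proof (intro conjI ballI)
      show "h ` K \<subseteq> ?S" using sub p il by (auto simp: h_def rees_carrier_def)
    next
      fix a b assume "a \<in> h ` K" "b \<in> h ` K"
      then obtain x y where xy: "x \<in> K" "y \<in> K" and ab: "a = h x" "b = h y" by auto
      have comm: "x \<otimes>\<^bsub>G\<^esub> y = y \<otimes>\<^bsub>G\<^esub> x"
        using K(1) xy by (simp add: commuting_set_def)
      have "x \<otimes>\<^bsub>G\<^esub> inv\<^bsub>G\<^esub> P l i \<in> carrier G" "y \<otimes>\<^bsub>G\<^esub> inv\<^bsub>G\<^esub> P l i \<in> carrier G"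
        using subsetD[OF sub xy(1)] subsetD[OF sub xy(2)] p by simp_all
      note iff = rees_commute_iff[where P = P, OF grp p this, of i l]
      show "?f a b = ?f b a"
        unfolding ab h_def iff cancel[OF xy(1)] cancel[OF xy(2)] using comm by (intro conjI refl)
    qed
    then have "card (h ` K) \<le> commuting_width ?S ?f"
      by (rule card_le_commuting_width[OF finS])
    then show ?thesis using K(2) card_image[OF inj] by simp
  qed
qed

theorem theorem3p6:
  fixes G :: "('g, 'm) monoid_scheme"
    and I :: "'i set" and \<Lambda> :: "'l set"
    and P :: "'l \<Rightarrow> 'i \<Rightarrow> 'g"
  assumes "group G" and "finite (carrier G)"
    and "finite I" and "I \<noteq> {}"
    and "finite \<Lambda>" and "\<Lambda> \<noteq> {}"
    and "\<forall>l\<in>\<Lambda>. \<forall>i\<in>I. P l i \<in> carrier G"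
    and "card I > 1 \<or> card \<Lambda> > 1"
  shows "(comm_group G \<longrightarrow>
            clique_number (commuting_graph (rees_carrier G I \<Lambda>) (rees_mult G P)) = order G) \<and>
         (\<not> comm_group G \<longrightarrow>
            clique_number (commuting_graph (rees_carrier G I \<Lambda>) (rees_mult G P)) =
              card (center (carrier G) (mult G)) +
              clique_number (commuting_graph (carrier G) (mult G)))"
proof -
  let ?S = "rees_carrier G I \<Lambda>" and ?f = "rees_mult G P"
  have "finite ?S" using assms(2,3,5) by (simp add: rees_carrier_def)
  then have "clique_number (commuting_graph ?S ?f) = commuting_width ?S ?f"
    using rees_center_empty[OF assms(1,4,6,8), of P] by (simp add: commuting_width_eq)
  also have "\<dots> = commuting_width (carrier G) (mult G)"
    using assms(1-7) by (rule commuting_width_rees)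
  finally have width: "clique_number (commuting_graph ?S ?f) = commuting_width (carrier G) (mult G)" .
  have "commuting_width (carrier G) (mult G) = order G" if "comm_group G"
  proof (rule antisym)
    interpret comm_group G by fact
    obtain K where "commuting_set (carrier G) (mult G) K"
      "card K = commuting_width (carrier G) (mult G)"
      using commuting_width_attained[OF assms(2)] .
    then show "commuting_width (carrier G) (mult G) \<le> order G"
      using card_mono[OF assms(2), of K] by (simp add: commuting_set_def order_def)
    have "commuting_set (carrier G) (mult G) (carrier G)"
      by (simp add: commuting_set_def m_comm)
    then show "order G \<le> commuting_width (carrier G) (mult G)"
      unfolding order_def by (rule card_le_commuting_width[OF assms(2)])
  qed
  with width commuting_width_eq[OF assms(2), of "mult G"] show ?thesis by simp
qed

end
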